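(* Let $C_{\max},D_{\max}\geq 0$ with $C_{\max}\le S_{\max}/\alpha_c$ and $D_{\max}\le\alpha_dS_{\max}$. Consider the problem of minimizing, over all policies $\pi=\{(G_i,C_i,D_i)\}$ admissible for the rate-constrained system described in the context, the cost $$J_L(\pi,S_1)=\limsup_{n\to\infty}\mathbb{E}\Big[\frac1n\sum_{i=1}^n1_{\{\Delta_i<-G_{\max}-\min\{\alpha_dS_i,D_{\max}\}\}}\Big]$$ where $\Delta_1,\Delta_2,\ldots$ is an arbitrary random process. Then the policy $\pi^{(4)}$ given by $$C_i^{(4)}=\min\{C_i^{(2)},C_{\max}\},\qquad D_i^{(4)}=\min\{D_i^{(2)},D_{\max}\},\qquad G_i^{(4)}=\min\{[C_i^{(4)}-D_i^{(4)}-\Delta_i]^+,G_{\max}\}$$ is optimal, where $C_i^{(2)},D_i^{(2)}$ are the functions of $(S_i,\Delta_i)$ defined in the context (evaluated at the current stored power $S_i$ and the current $\Delta_i$).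
   Context: Single-bus power system with storage in slotted time $i=1,2,\ldots$. Constants: charging efficiency $\alpha_c\in(0,1)$, discharging efficiency $\alpha_d\in(0,1)$, conventional generation capacity $G_{\max}\ge0$, power storage capacity $S_{\max}\ge0$, rated charging power $C_{\max}$ and rated discharging power $D_{\max}$. Notation $[x]^+=\max\{x,0\}$. The net renewable generation $\Delta_1,\Delta_2,\ldots$ is an exogenous real-valued random process (its law is not affected by the controls). The initial stored power $S_1\in[0,S_{\max}]$ is given. An admissible policy chooses $(G_i,C_i,D_i)$ (conventional generation, charging, discharging) as a measurable function of $(S_1,\Delta_1,\ldots,S_{i-1},\Delta_{i-1},S_i)$ and $\Delta_i$ such that for all $i$: $$S_{i+1}=S_i+\alpha_cC_i-\frac1{\alpha_d}D_i,\quad 0\le S_i\le S_{\max},\quad 0\le C_i\le C_{\max},\quad 0\le D_i\le D_{\max},\quad 0\le G_i\le G_{\max},$$ $$0\le G_i-C_i+D_i+\max\{\Delta_i,-G_{\max}-\min\{\alpha_dS_i,D_{\max}\}\}.$$ The functions $C^{(2)}_i,D^{(2)}_i$ of $(S_i,\Delta_i)$ are: - if $-G_{\max}+\frac{S_{\max}-S_i}{\alpha_c}\le\Delta_i$: $C^{(2)}_i=\frac{S_{\max}-S_i}{\alpha_c}$, $D^{(2)}_i=0$; - if $-G_{\max}\le\Delta_i<-G_{\max}+\frac{S_{\max}-S_i}{\alpha_c}$: $C^{(2)}_i=G_{\max}+\Delta_i$, $D^{(2)}_i=0$; - if $-G_{\max}-\alpha_dS_i\le\Delta_i<-G_{\max}$: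 $C^{(2)}_i=0$, $D^{(2)}_i=-\Delta_i-G_{\max}$; - if $\Delta_i<-G_{\max}-\alpha_dS_i$: $C^{(2)}_i=0$, $D^{(2)}_i=\alpha_dS_i$. Optimal means that $J_L(\pi^{(4)},S_1)\le J_L(\pi,S_1)$ for every admissible $\pi$. *)

theory Defs
  imports "HOL-Probability.Probability"
begin

record storage_system =
  charge_eff :: real
  discharge_eff :: real
  gen_max :: real
  store_max :: real
  charge_max :: real
  discharge_max :: real

definition valid_system :: "storage_system \<Rightarrow> bool" where
  "valid_system P \<longleftrightarrow>
     0 < charge_eff P \<and> charge_eff P < 1 \<and> 0 < discharge_eff P \<and> discharge_eff P < 1 \<and>
     0 \<le> gen_max P \<and> 0 \<le> store_max P \<and>
     0 \<le> charge_max P \<and> charge_max P \<le> store_max P / charge_eff P \<and>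
     0 \<le> discharge_max P \<and> discharge_max P \<le> discharge_eff P * store_max P"

text \<open>
  Time slots are \<open>1, 2, \<dots>\<close>; values at index 0 are never used. The controls in slot \<open>i\<close> are
  functions of the stored powers and net renewable generations in slots \<open>1, \<dots>, i\<close>, both
  given as extensional functions on \<open>{1..i}\<close>.
\<close>

type_synonym history = "(nat \<Rightarrow> real) \<times> (nat \<Rightarrow> real)"

definition history_space :: "nat \<Rightarrow> history measure" where
  "history_space i = PiM {1..i} (\<lambda>_. borel) \<Otimes>\<^sub>M PiM {1..i} (\<lambda>_. borel)"

record policy =
  gen :: "nat \<Rightarrow> history \<Rightarrow> real"
  charge :: "nat \<Rightarrow> history \<Rightarrow> real"
  discharge :: "nat \<Rightarrow> history \<Rightarrow> real"

definition measurable_policy :: "policy \<Rightarrow> bool" where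
  "measurable_policy \<pi> \<longleftrightarrow>
     (\<forall>i\<ge>1. gen \<pi> i \<in> borel_measurable (history_space i) \<and>
            charge \<pi> i \<in> borel_measurable (history_space i) \<and>
            discharge \<pi> i \<in> borel_measurable (history_space i))"

text \<open>
  \<open>store_hist P \<pi> s1 d i\<close> is the function \<open>(S\<^sub>1, \<dots>, S\<^sub>i)\<close> on \<open>{1..i}\<close> that results from
  \<open>S\<^sub>1 = s1\<close> and the realization \<open>d\<close> of the net renewable generation.
\<close>

primrec store_hist ::
  "storage_system \<Rightarrow> policy \<Rightarrow> real \<Rightarrow> (nat \<Rightarrow> real) \<Rightarrow> nat \<Rightarrow> (nat \<Rightarrow> real)" where
  "store_hist P \<pi> s1 d 0 = (\<lambda>_. undefined)"
| "store_hist P \<pi> s1 d (Suc i) = (store_hist P \<pi> s1 d i)(Suc i :=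
     (if i = 0 then s1
      else let h = (store_hist P \<pi> s1 d i, restrict d {1..i})
           in store_hist P \<pi> s1 d i i + charge_eff P * charge \<pi> i h
                - (1 / discharge_eff P) * discharge \<pi> i h))"

definition store :: "storage_system \<Rightarrow> policy \<Rightarrow> real \<Rightarrow> (nat \<Rightarrow> real) \<Rightarrow> nat \<Rightarrow> real" where
  "store P \<pi> s1 d i = store_hist P \<pi> s1 d i i"

definition history_at ::
  "storage_system \<Rightarrow> policy \<Rightarrow> real \<Rightarrow> (nat \<Rightarrow> real) \<Rightarrow> nat \<Rightarrow> history" where
  "history_at P \<pi> s1 d i = (store_hist P \<pi> s1 d i, restrict d {1..i})"

definition feasible_path :: "storage_system \<Rightarrow> policy \<Rightarrow> real \<Rightarrow> (nat \<Rightarrow> real) \<Rightarrow> bool" where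
  "feasible_path P \<pi> s1 d \<longleftrightarrow>
     (\<forall>i\<ge>1. let S = store P \<pi> s1 d i; h = history_at P \<pi> s1 d i;
                 G = gen \<pi> i h; C = charge \<pi> i h; D = discharge \<pi> i h
             in 0 \<le> S \<and> S \<le> store_max P \<and>
                0 \<le> C \<and> C \<le> charge_max P \<and>
                0 \<le> D \<and> D \<le> discharge_max P \<and>
                0 \<le> G \<and> G \<le> gen_max P \<and>
                0 \<le> G - C + D
                     + max (d i) (- gen_max P - min (discharge_eff P * S) (discharge_max P)))"

definition admissible ::
  "storage_system \<Rightarrow> 'w measure \<Rightarrow> (nat \<Rightarrow> 'w \<Rightarrow> real) \<Rightarrow> real \<Rightarrow> policy \<Rightarrow> bool" where
  "admissible P M \<Delta> s1 \<pi> \<longleftrightarrow>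
     measurable_policy \<pi> \<and> (AE w in M. feasible_path P \<pi> s1 (\<lambda>i. \<Delta> i w))"

definition loss_cost ::
  "storage_system \<Rightarrow> 'w measure \<Rightarrow> (nat \<Rightarrow> 'w \<Rightarrow> real) \<Rightarrow> policy \<Rightarrow> real \<Rightarrow> ereal" where
  "loss_cost P M \<Delta> \<pi> s1 =
     limsup (\<lambda>n. ereal (LINT w|M. (1 / real n) *
       (\<Sum>i=1..n. of_bool (\<Delta> i w < - gen_max P
          - min (discharge_eff P * store P \<pi> s1 (\<lambda>j. \<Delta> j w) i) (discharge_max P)))))"

definition optimal ::
  "storage_system \<Rightarrow> 'w measure \<Rightarrow> (nat \<Rightarrow> 'w \<Rightarrow> real) \<Rightarrow> real \<Rightarrow> policy \<Rightarrow> bool" where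
  "optimal P M \<Delta> s1 \<pi> \<longleftrightarrow> admissible P M \<Delta> s1 \<pi> \<and>
     (\<forall>\<pi>'. admissible P M \<Delta> s1 \<pi>' \<longrightarrow> loss_cost P M \<Delta> \<pi> s1 \<le> loss_cost P M \<Delta> \<pi>' s1)"

definition C2 :: "storage_system \<Rightarrow> real \<Rightarrow> real \<Rightarrow> real" where
  "C2 P s x =
     (if - gen_max P + (store_max P - s) / charge_eff P \<le> x then (store_max P - s) / charge_eff P
      else if - gen_max P \<le> x then gen_max P + x
      else 0)"

definition D2 :: "storage_system \<Rightarrow> real \<Rightarrow> real \<Rightarrow> real" where
  "D2 P s x =
     (if - gen_max P + (store_max P - s) / charge_eff P \<le> x then 0
      else if - gen_max P \<le> x then 0
      else if - gen_max P - discharge_eff P * s \<le> x then - x - gen_max P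
      else discharge_eff P * s)"

definition C4 :: "storage_system \<Rightarrow> real \<Rightarrow> real \<Rightarrow> real" where
  "C4 P s x = min (C2 P s x) (charge_max P)"

definition D4 :: "storage_system \<Rightarrow> real \<Rightarrow> real \<Rightarrow> real" where
  "D4 P s x = min (D2 P s x) (discharge_max P)"

definition G4 :: "storage_system \<Rightarrow> real \<Rightarrow> real \<Rightarrow> real" where
  "G4 P s x = min (max (C4 P s x - D4 P s x - x) 0) (gen_max P)"

definition policy4 :: "storage_system \<Rightarrow> policy" where
  "policy4 P =
     \<lparr>gen = (\<lambda>i h. G4 P (fst h i) (snd h i)),
      charge = (\<lambda>i h. C4 P (fst h i) (snd h i)),
      discharge = (\<lambda>i h. D4 P (fst h i) (snd h i))\<rparr>"

end

theory Submission
  imports Defs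
begin

text \<open>
  The comparison is pathwise. Starting from the same stored power, the greedy policy keeps at
  least as much energy in storage as any other feasible policy: its storage update is monotone
  in the stored power, and no feasible control yields a larger update from the same state.
  Since the loss event in each slot shrinks as the stored power grows, greedy losses are
  contained in those of every competitor, slot by slot.
\<close>

text \<open>Since the free room \<open>(store_max P - s) / charge_eff P\<close> is nonnegative, the
  cases of \<open>C2\<close> clamp the surplus \<open>gen_max P + x\<close> between 0 and that room.
  Charging is then the least of three limits, each of which also binds a competitor.\<close>

lemma C4_eq:
  assumes "valid_system P" "s \<le> store_max P"
  shows "C4 P s x =
    max 0 (min (gen_max P + x) (min ((store_max P - s) / charge_eff P) (charge_max P)))"
proof -
  have "0 \<le> (store_max P - s) / charge_eff P"
    using assms by (simp add: valid_system_def)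
  then show ?thesis
    using assms(1) by (auto simp: C4_def C2_def valid_system_def min_def max_def)
qed

lemma D4_eq:
  assumes "valid_system P" "0 \<le> s" "s \<le> store_max P"
  shows "D4 P s x =
    max 0 (min (- x - gen_max P) (min (discharge_eff P * s) (discharge_max P)))"
proof -
  have "0 \<le> (store_max P - s) / charge_eff P" "0 \<le> discharge_eff P * s"
    using assms by (simp_all add: valid_system_def)
  then show ?thesis
    using assms(1) by (auto simp: D4_def D2_def valid_system_def min_def max_def)
qed

section \<open>One slot: feasibility and comparison of controls\<close>

definition feasible_control ::
  "storage_system \<Rightarrow> real \<Rightarrow> real \<Rightarrow> real \<Rightarrow> real \<Rightarrow> real \<Rightarrow> bool" where
  "feasible_control P s x G C D \<longleftrightarrow>
     0 \<le> C \<and> C \<le> charge_max P \<and> 0 \<le> D \<and> D \<le> discharge_max P \<and> 0 \<le> G \<and> G \<le> gen_max P \<and>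
     0 \<le> G - C + D + max x (- gen_max P - min (discharge_eff P * s) (discharge_max P))"

definition next_store :: "storage_system \<Rightarrow> real \<Rightarrow> real \<Rightarrow> real \<Rightarrow> real" where
  "next_store P s C D = s + charge_eff P * C - (1 / discharge_eff P) * D"

lemma feasible_control_greedy:
  assumes "valid_system P" "0 \<le> s" "s \<le> store_max P"
  shows "feasible_control P s x (G4 P s x) (C4 P s x) (D4 P s x)"
proof -
  let ?c = "C4 P s x" and ?d = "D4 P s x" and ?G = "gen_max P"
  let ?m = "min (discharge_eff P * s) (discharge_max P)"
  have G: "0 \<le> ?G" and c: "0 \<le> ?c" "?c \<le> charge_max P"
    and d: "0 \<le> ?d" "?d \<le> discharge_max P" and m: "0 \<le> ?m"
    using assms unfolding C4_eq[OF assms(1,3)] D4_eq[OF assms]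
    by (auto simp: valid_system_def)
  have "0 \<le> G4 P s x - ?c + ?d + max x (- ?G - ?m)"
  proof (cases "- ?G \<le> x")
    case True
    have "?d = 0" using True unfolding D4_eq[OF assms] by auto
    moreover have "?c \<le> ?G + x" using True unfolding C4_eq[OF assms(1,3)] by auto
    ultimately have "?c - ?d - x \<le> G4 P s x" using G by (simp add: G4_def)
    then show ?thesis by linarith
  next
    case False
    have c0: "?c = 0" using False unfolding C4_eq[OF assms(1,3)] by auto
    have d_eq: "?d = min (- x - ?G) ?m" using False m unfolding D4_eq[OF assms] by simp
    then have "?G \<le> ?c - ?d - x" unfolding c0 by linarith
    then have "G4 P s x = ?G" using G by (simp add: G4_def)
    \<comment> \<open>In a deficit the balance holds with equality: \<open>max x (- ?G - ?m)\<close>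
      is \<open>- ?G - min (- x - ?G) ?m\<close>, and generation plus discharge cancel it.\<close>
    then show ?thesis unfolding c0 d_eq by linarith
  qed
  moreover have "0 \<le> G4 P s x" "G4 P s x \<le> ?G" using G by (auto simp: G4_def)
  ultimately show ?thesis using c d by (simp add: feasible_control_def)
qed

lemma next_store_greedy_bounds:
  assumes "valid_system P" "0 \<le> s" "s \<le> store_max P"
  shows "0 \<le> next_store P s (C4 P s x) (D4 P s x)"
    and "next_store P s (C4 P s x) (D4 P s x) \<le> store_max P"
proof -
  have pos: "0 < charge_eff P" "0 < discharge_eff P"
    using assms by (auto simp: valid_system_def)
  have "0 \<le> (store_max P - s) / charge_eff P" "0 \<le> discharge_eff P * s"
    using assms pos by simp_all
  then have "0 \<le> C4 P s x" "C4 P s x \<le> (store_max P - s) / charge_eff P"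
    "0 \<le> D4 P s x" "D4 P s x \<le> discharge_eff P * s"
    unfolding C4_eq[OF assms(1,3)] D4_eq[OF assms] by auto
  then have "0 \<le> charge_eff P * C4 P s x" "charge_eff P * C4 P s x \<le> store_max P - s"
    "0 \<le> D4 P s x / discharge_eff P" "D4 P s x / discharge_eff P \<le> s"
    using pos by (auto simp: field_simps)
  then show "0 \<le> next_store P s (C4 P s x) (D4 P s x)"
    "next_store P s (C4 P s x) (D4 P s x) \<le> store_max P"
    by (simp_all add: next_store_def)
qed

text \<open>Charging and discharging at once wastes energy, because \<open>charge_eff P\<close> < 1
  < \<open>1 / discharge_eff P\<close>. Hence only the net charge \<open>C - D\<close> matters for
  an upper bound; the first form serves a surplus, the second a deficit.\<close>

lemma next_store_le_net:
  assumes "valid_system P" "0 \<le> C" "0 \<le> D"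
  shows "next_store P t C D \<le> t + charge_eff P * (C - D)"
    and "next_store P t C D \<le> t - (D - C) / discharge_eff P"
proof -
  have eff: "0 < charge_eff P" "charge_eff P < 1" "0 < discharge_eff P" "discharge_eff P < 1"
    using assms(1) by (auto simp: valid_system_def)
  have "1 \<le> 1 / discharge_eff P" using eff by simp
  then have le: "charge_eff P \<le> 1 / discharge_eff P" using eff by linarith
  show "next_store P t C D \<le> t + charge_eff P * (C - D)"
    using mult_right_mono[OF le \<open>0 \<le> D\<close>] by (simp add: next_store_def algebra_simps)
  show "next_store P t C D \<le> t - (D - C) / discharge_eff P"
    using mult_right_mono[OF le \<open>0 \<le> C\<close>] by (simp add: next_store_def diff_divide_distrib)
qed

text \<open>In a surplus, whichever limit stops the greedy charge also limits the competitor, who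
  starts no higher. In a deficit, greedy discharge exceeds what the competitor must deliver by no
  more than the head start \<open>s - t\<close> can pay for.\<close>

lemma next_store_le_greedy:
  assumes P: "valid_system P" and t: "0 \<le> t" "t \<le> s" and s: "s \<le> store_max P"
    and feas: "feasible_control P t x G C D" and cap: "next_store P t C D \<le> store_max P"
  shows "next_store P t C D \<le> next_store P s (C4 P s x) (D4 P s x)"
proof -
  have eff: "0 < charge_eff P" "0 < discharge_eff P"
    and nonneg: "0 \<le> charge_max P" "0 \<le> discharge_max P"
    using P by (auto simp: valid_system_def)
  have s0: "0 \<le> s" using t by simp
  have room: "0 \<le> (store_max P - s) / charge_eff P" using s eff by simp
  have stored: "0 \<le> discharge_eff P * t" "0 \<le> discharge_eff P * s" using t eff by simp_all
  have CD: "0 \<le> C" "C \<le> charge_max P" "0 \<le> D" "G \<le> gen_max P"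
    and balance: "0 \<le> G - C + D
      + max x (- gen_max P - min (discharge_eff P * t) (discharge_max P))"
    using feas by (auto simp: feasible_control_def)
  note net = next_store_le_net[OF P CD(1,3), of t]
  show ?thesis
  proof (cases "- gen_max P \<le> x")
    case True
    have D4: "D4 P s x = 0"
      using True unfolding D4_eq[OF P s0 s] by auto
    \<comment> \<open>In a surplus the maximum in the balance is \<open>x\<close> itself, and
      \<open>G\<close> is at most \<open>gen_max P\<close>.\<close>
    have "C - D \<le> gen_max P + x"
      using balance True CD stored nonneg by (auto simp: max_def min_def split: if_splits)
    moreover have "C - D \<le> charge_max P" using CD by simp
    ultimately have "next_store P t C D \<le> s + charge_eff P * (gen_max P + x)"
      "next_store P t C D \<le> s + charge_eff P * charge_max P"
      using net(1) t(2) eff(1) mult_left_mono[of "C - D" _ "charge_eff P"]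
      by (smt (verit))+
    \<comment> \<open>The right-hand side is just \<open>store_max P\<close>: a greedy policy
      limited by room fills the storage, so here the capacity bound on the competitor's next state
      decides.\<close>
    moreover have "next_store P t C D
        \<le> s + charge_eff P * ((store_max P - s) / charge_eff P)"
      using cap eff by simp
    \<comment> \<open>All three limits are nonnegative, so the clamp at 0 is inactive and the greedy
      charge attains one of the bounds just shown.\<close>
    moreover have "C4 P s x \<in>
        {gen_max P + x, charge_max P, (store_max P - s) / charge_eff P}"
      using True room nonneg unfolding C4_eq[OF P s] by (auto simp: min_def max_def)
    ultimately show ?thesis
      unfolding next_store_def[of P s] D4 by auto
  next
    case False
    define need where "need = - x - gen_max P"
    \<comment> \<open>Greedy discharge as a function of the stored power, with the deficit held
      fixed, so that levels \<open>t\<close> and \<open>s\<close> can be compared.\<close>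
    define delivered where
      "delivered = (\<lambda>u. min need (min (discharge_eff P * u) (discharge_max P)))"
    have C4: "C4 P s x = 0"
      using False unfolding C4_eq[OF P s] by auto
    have D4: "D4 P s x = delivered s"
      using False stored nonneg unfolding D4_eq[OF P s0 s] delivered_def need_def by auto
    \<comment> \<open>Even with full generation, the balance forces a net discharge of
      \<open>- gen_max P - max x (...)\<close>, which is \<open>delivered t\<close>.\<close>
    have "delivered t \<le> D - C"
      using balance CD by (auto simp: delivered_def need_def max_def min_def split: if_splits)
    then have "delivered t / discharge_eff P \<le> (D - C) / discharge_eff P"
      using eff by (simp add: divide_right_mono)
    then have "next_store P t C D \<le> t - delivered t / discharge_eff P"
      using net(2) by linarith
    also have "\<dots> \<le> s - delivered s / discharge_eff P"
    proof -
      have "discharge_eff P * t \<le> discharge_eff P * s"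
        using t(2) eff by (simp add: mult_left_mono)
      \<comment> \<open>\<open>delivered\<close> grows with slope at most
        \<open>discharge_eff P\<close>, so the extra discharge drains at most \<open>s - t\<close>
        from storage.\<close>
      then have "delivered s - delivered t \<le> discharge_eff P * (s - t)"
        by (auto simp: delivered_def min_def right_diff_distrib)
      then have "(delivered s - delivered t) / discharge_eff P \<le> s - t"
        using eff by (simp add: pos_divide_le_eq mult.commute)
      then show ?thesis by (simp add: diff_divide_distrib)
    qed
    finally show ?thesis
      unfolding next_store_def[of P s] C4 D4 by simp
  qed
qed

section \<open>Trajectories: feasibility and pathwise dominance\<close>

lemma store_1: "store P \<pi> s1 d (Suc 0) = s1"
  by (simp add: store_def)

lemma store_Suc:
  assumes "i \<ge> 1"
  shows "store P \<pi> s1 d (Suc i) = next_store P (store P \<pi> s1 d i)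
    (charge \<pi> i (history_at P \<pi> s1 d i)) (discharge \<pi> i (history_at P \<pi> s1 d i))"
  using assms by (simp add: store_def next_store_def history_at_def Let_def)

lemma feasible_path_iff:
  "feasible_path P \<pi> s1 d \<longleftrightarrow>
     (\<forall>i\<ge>1. 0 \<le> store P \<pi> s1 d i \<and> store P \<pi> s1 d i \<le> store_max P \<and>
       feasible_control P (store P \<pi> s1 d i) (d i) (gen \<pi> i (history_at P \<pi> s1 d i))
         (charge \<pi> i (history_at P \<pi> s1 d i)) (discharge \<pi> i (history_at P \<pi> s1 d i)))"
  by (simp add: feasible_path_def feasible_control_def Let_def)

lemma policy4_controls:
  assumes "i \<ge> 1"
  shows "gen (policy4 P) i (history_at P \<pi> s1 d i) = G4 P (store P \<pi> s1 d i) (d i)"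
    and "charge (policy4 P) i (history_at P \<pi> s1 d i) = C4 P (store P \<pi> s1 d i) (d i)"
    and "discharge (policy4 P) i (history_at P \<pi> s1 d i) = D4 P (store P \<pi> s1 d i) (d i)"
  using assms by (simp_all add: policy4_def history_at_def store_def)

lemma store_policy4_bounds:
  assumes "valid_system P" "0 \<le> s1" "s1 \<le> store_max P" "i \<ge> 1"
  shows "0 \<le> store P (policy4 P) s1 d i \<and> store P (policy4 P) s1 d i \<le> store_max P"
  using \<open>i \<ge> 1\<close>
proof (induction i rule: dec_induct)
  case base
  then show ?case using assms by (simp add: store_1)
next
  case (step i)
  then show ?case
    using next_store_greedy_bounds[OF assms(1)] by (simp add: store_Suc policy4_controls)
qed

lemma feasible_path_policy4:
  assumes "valid_system P" "0 \<le> s1" "s1 \<le> store_max P"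
  shows "feasible_path P (policy4 P) s1 d"
  unfolding feasible_path_iff
  using store_policy4_bounds[OF assms] feasible_control_greedy[OF assms(1)]
  by (simp add: policy4_controls)

lemma store_le_policy4:
  assumes "valid_system P" "0 \<le> s1" "s1 \<le> store_max P"
    and feas: "feasible_path P \<pi> s1 d" and "i \<ge> 1"
  shows "store P \<pi> s1 d i \<le> store P (policy4 P) s1 d i"
  using \<open>i \<ge> 1\<close>
proof (induction i rule: dec_induct)
  case base
  then show ?case by (simp add: store_1)
next
  case (step i)
  \<comment> \<open>The capacity premise of \<open>next_store_le_greedy\<close> concerns the state
    after the update, so it comes from feasibility in the following slot.\<close>
  have "store P \<pi> s1 d (Suc i) \<le> store_max P"
    using feas by (auto simp: feasible_path_iff)
  then show ?case
    using step feas store_policy4_bounds[OF assms(1-3) step(1)]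
    unfolding store_Suc[OF step(1)] policy4_controls[OF step(1)] feasible_path_iff
    by (intro next_store_le_greedy[OF assms(1)]) auto
qed

section \<open>Measurability, integrability and expected cost\<close>

lemma measurable_policy4: "measurable_policy (policy4 P)"
proof -
  have [measurable]: "(\<lambda>h. fst h i) \<in> borel_measurable (history_space i)"
    "(\<lambda>h. snd h i) \<in> borel_measurable (history_space i)" if "i \<ge> 1" for i
    using that unfolding history_space_def
    by (auto intro!: measurable_compose[OF measurable_fst measurable_component_singleton]
      measurable_compose[OF measurable_snd measurable_component_singleton])
  show ?thesis
    unfolding measurable_policy_def policy4_def G4_def C4_def D4_def C2_def D2_def
    by (intro allI impI conjI) (simp, measurable)+
qed

text \<open>The induction carries the whole history, not just the current state, because a general
  policy composes its controls with all of it.\<close>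

lemma measurable_store_hist:
  assumes \<pi>: "measurable_policy \<pi>"
    and \<Delta>: "\<And>i. i \<ge> 1 \<Longrightarrow> \<Delta> i \<in> borel_measurable M"
  shows "(\<lambda>w. store_hist P \<pi> s1 (\<lambda>j. \<Delta> j w) i) \<in> M \<rightarrow>\<^sub>M PiM {1..i} (\<lambda>_. borel)"
proof (induction i)
  case 0
  \<comment> \<open>The product over the empty index set has the everywhere \<open>undefined\<close>
    function as its only point, matching the value of \<open>store_hist\<close> at 0.\<close>
  then show ?case by (auto simp: space_PiM)
next
  case (Suc i)
  let ?next = "\<lambda>w. if i = 0 then s1
      else let h = (store_hist P \<pi> s1 (\<lambda>j. \<Delta> j w) i, restrict (\<lambda>j. \<Delta> j w) {1..i})
           in store_hist P \<pi> s1 (\<lambda>j. \<Delta> j w) i i + charge_eff P * charge \<pi> i h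
                - (1 / discharge_eff P) * discharge \<pi> i h"
  have "?next \<in> borel_measurable M"
  proof (cases "i = 0")
    case False
    then have i: "i \<ge> 1" by simp
    have "(\<lambda>w. restrict (\<lambda>j. \<Delta> j w) {1..i}) \<in> M \<rightarrow>\<^sub>M PiM {1..i} (\<lambda>_. borel)"
      using \<Delta> by (intro measurable_restrict) simp
    then have h: "(\<lambda>w. (store_hist P \<pi> s1 (\<lambda>j. \<Delta> j w) i, restrict (\<lambda>j. \<Delta> j w) {1..i}))
        \<in> M \<rightarrow>\<^sub>M history_space i"
      unfolding history_space_def using Suc.IH by (rule measurable_Pair[rotated])
    have [measurable]: "(\<lambda>w. store_hist P \<pi> s1 (\<lambda>j. \<Delta> j w) i i) \<in> borel_measurable M"
      using measurable_compose[OF Suc.IH measurable_component_singleton[of i]] i by simp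
    have [measurable]:
      "(\<lambda>w. charge \<pi> i (store_hist P \<pi> s1 (\<lambda>j. \<Delta> j w) i, restrict (\<lambda>j. \<Delta> j w) {1..i}))
        \<in> borel_measurable M"
      "(\<lambda>w. discharge \<pi> i (store_hist P \<pi> s1 (\<lambda>j. \<Delta> j w) i, restrict (\<lambda>j. \<Delta> j w) {1..i}))
        \<in> borel_measurable M"
      using \<pi>[unfolded measurable_policy_def, rule_format, OF i]
      by (blast intro: measurable_compose[OF h])+
    show ?thesis unfolding if_not_P[OF False] Let_def by measurable
  qed simp
  then have "(\<lambda>w. (store_hist P \<pi> s1 (\<lambda>j. \<Delta> j w) i)(Suc i := ?next w))
      \<in> M \<rightarrow>\<^sub>M PiM {1..Suc i} (\<lambda>_. borel)"
    by (intro measurable_fun_upd[OF _ Suc.IH]) (auto simp: atLeastAtMostSuc_conv)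
  then show ?case unfolding store_hist.simps(2) .
qed

lemma measurable_store:
  assumes "measurable_policy \<pi>" "\<And>i. i \<ge> 1 \<Longrightarrow> \<Delta> i \<in> borel_measurable M" "i \<ge> 1"
  shows "(\<lambda>w. store P \<pi> s1 (\<lambda>j. \<Delta> j w) i) \<in> borel_measurable M"
  using measurable_compose[OF measurable_store_hist[OF assms(1,2)]
      measurable_component_singleton[of i]] assms(3)
  by (simp add: store_def)

text \<open>Each loss indicator is measurable and bounded by 1 on a probability space. Integrability
  is what lets an almost sure inequality pass to the integrals.\<close>

lemma integrable_average_loss:
  assumes "prob_space M" "measurable_policy \<pi>" "\<And>i. i \<ge> 1 \<Longrightarrow> \<Delta> i \<in> borel_measurable M"
  shows "integrable M (\<lambda>w. (1 / real n) * (\<Sum>i=1..n. of_bool (\<Delta> i w < - gen_max P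
          - min (discharge_eff P * store P \<pi> s1 (\<lambda>j. \<Delta> j w) i) (discharge_max P)) :: real))"
proof -
  interpret prob_space M by fact
  have "integrable M (\<lambda>w. of_bool (\<Delta> i w < - gen_max P
          - min (discharge_eff P * store P \<pi> s1 (\<lambda>j. \<Delta> j w) i) (discharge_max P)) :: real)"
    if "i \<in> {1..n}" for i
  proof (rule integrable_const_bound[where B = 1])
    have [measurable]: "\<Delta> i \<in> borel_measurable M"
      "(\<lambda>w. store P \<pi> s1 (\<lambda>j. \<Delta> j w) i) \<in> borel_measurable M"
      using that assms(3) measurable_store[OF assms(2,3)] by auto
    show "(\<lambda>w. of_bool (\<Delta> i w < - gen_max P
          - min (discharge_eff P * store P \<pi> s1 (\<lambda>j. \<Delta> j w) i) (discharge_max P)) :: real)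
        \<in> borel_measurable M"
      by measurable
  qed simp
  then show ?thesis by (intro integrable_mult_right Bochner_Integration.integrable_sum)
qed

theorem theorem4:
  fixes P :: storage_system and M :: "'w measure" and \<Delta> :: "nat \<Rightarrow> 'w \<Rightarrow> real" and s1 :: real
  assumes "valid_system P"
    and "prob_space M"
    and "\<And>i. i \<ge> 1 \<Longrightarrow> \<Delta> i \<in> borel_measurable M"
    and "0 \<le> s1" and "s1 \<le> store_max P"
  shows "optimal P M \<Delta> s1 (policy4 P)"
  unfolding optimal_def
proof (intro conjI allI impI)
  show "admissible P M \<Delta> s1 (policy4 P)"
    using feasible_path_policy4[OF assms(1,4,5)] measurable_policy4
    by (simp add: admissible_def)
next
  fix \<pi> assume adm: "admissible P M \<Delta> s1 \<pi>"
  then have feas: "AE w in M. feasible_path P \<pi> s1 (\<lambda>i. \<Delta> i w)"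
    and meas: "measurable_policy \<pi>"
    by (auto simp: admissible_def)
  have eff: "0 \<le> discharge_eff P" using assms(1) by (simp add: valid_system_def)
  show "loss_cost P M \<Delta> (policy4 P) s1 \<le> loss_cost P M \<Delta> \<pi> s1"
    unfolding loss_cost_def
  proof (intro Limsup_mono always_eventually allI, unfold ereal_less_eq,
      intro integral_mono_AE integrable_average_loss assms measurable_policy4 meas)
    fix n
    show "AE w in M.
      (1 / real n) * (\<Sum>i=1..n. of_bool (\<Delta> i w < - gen_max P
        - min (discharge_eff P * store P (policy4 P) s1 (\<lambda>j. \<Delta> j w) i) (discharge_max P)))
      \<le> (1 / real n) * (\<Sum>i=1..n. of_bool (\<Delta> i w < - gen_max P
        - min (discharge_eff P * store P \<pi> s1 (\<lambda>j. \<Delta> j w) i) (discharge_max P)))"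
      using feas
    proof eventually_elim
      case (elim w)
      show ?case
      proof (intro mult_left_mono sum_mono)
        fix i assume "i \<in> {1..n}"
        then have "discharge_eff P * store P \<pi> s1 (\<lambda>j. \<Delta> j w) i
            \<le> discharge_eff P * store P (policy4 P) s1 (\<lambda>j. \<Delta> j w) i"
          using store_le_policy4[OF assms(1,4,5) elim] eff by (simp add: mult_left_mono)
        then show "of_bool (\<Delta> i w < - gen_max P
            - min (discharge_eff P * store P (policy4 P) s1 (\<lambda>j. \<Delta> j w) i) (discharge_max P))
          \<le> (of_bool (\<Delta> i w < - gen_max P
            - min (discharge_eff P * store P \<pi> s1 (\<lambda>j. \<Delta> j w) i) (discharge_max P)) :: real)"
          by (auto simp: min_def split: if_splits)
      qed simp
    qed
  qed
qed

end
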